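(* Let $K$ be a field, $S=K[x_1,\ldots,x_n]$, and let $0\neq I\subset S$ be a monomial ideal with set of minimal monomial generators $G(I)$. For $1\leq k\leq n$ put $$\alpha_k(I)=\max\{j\;:\;x_k^j\mid u\text{ for all }u\in G(I)\},\qquad \beta_k(I)=\max\{j\;:\;x_k^j\mid u\text{ for some }u\in G(I)\}.$$ Then $$\operatorname{slength}(I)\leq \prod_{k=2}^n \bigl(\beta_k(I)-\alpha_k(I)+1\bigr).$$
   Context: Let $M$ be a finitely generated $\mathbb Z^n$-graded (multigraded) $S$-module, $S=K[x_1,\ldots,x_n]$. A Stanley decomposition of $M$ is a finite direct sum of $K$-vector spaces $\mathcal D: M=\bigoplus_{i=1}^r m_iK[Z_i]$, where each $m_i\in M$ is homogeneous, $Z_i\subset\{x_1,\ldots,x_n\}$, and $m_iK[Z_i]$ is a free $K[Z_i]$-module. Its length is $\operatorname{slength}(\mathcal D)=r$, and the Stanley length of $M$ is $\operatorname{slength}(M)=\min\{\operatorname{slength}(\mathcal D):\mathcal D\text{ is a Stanley decomposition of }M\}$. An empty product equals $1$. *)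

theory Defs
  imports "HOL-Library.Poly_Mapping" "HOL-Algebra.Ideal" "HOL-Algebra.Divisibility"
begin

text \<open>An exponent vector is a finitely supported map from variable indices to \<^typ>\<open>nat\<close>; the
  variable $x_k$ has index $k$.\<close>

type_synonym 'k mpoly = "(nat \<Rightarrow>\<^sub>0 nat) \<Rightarrow>\<^sub>0 'k"

definition Var :: "nat \<Rightarrow> 'k::field mpoly" where
  "Var k = Poly_Mapping.single (Poly_Mapping.single k 1) 1"

text \<open>The subring $K[Z]$, where \<open>Z\<close> is the set of indices of the variables involved.\<close>

definition polys :: "nat set \<Rightarrow> 'k::field mpoly set" where
  "polys Z = {p. \<forall>t\<in>Poly_Mapping.keys p. Poly_Mapping.keys t \<subseteq> Z}"

definition poly_ring :: "nat \<Rightarrow> 'k::field mpoly ring" where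
  "poly_ring n = \<lparr>carrier = polys {1..n}, monoid.mult = (*), one = 1, zero = 0, add = (+)\<rparr>"

definition monomials :: "nat \<Rightarrow> 'k::field mpoly set" where
  "monomials n = {Poly_Mapping.single t 1 |t. Poly_Mapping.keys t \<subseteq> {1..n}}"

definition monomial_ideal :: "nat \<Rightarrow> 'k::field mpoly set \<Rightarrow> bool" where
  "monomial_ideal n I \<longleftrightarrow> (\<exists>U. U \<subseteq> monomials n \<and> I = Idl\<^bsub>poly_ring n\<^esub> U)"

definition minimal_monomial_generating_set ::
    "nat \<Rightarrow> 'k::field mpoly set \<Rightarrow> 'k mpoly set \<Rightarrow> bool" where
  "minimal_monomial_generating_set n I G \<longleftrightarrow>
     G \<subseteq> monomials n \<and> Idl\<^bsub>poly_ring n\<^esub> G = I \<and> (\<forall>H. H \<subset> G \<longrightarrow> Idl\<^bsub>poly_ring n\<^esub> H \<noteq> I)"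

text \<open>A monomial ideal has exactly one minimal set of monomial generators.\<close>

definition min_gens :: "nat \<Rightarrow> 'k::field mpoly set \<Rightarrow> 'k mpoly set" where
  "min_gens n I = (THE G. minimal_monomial_generating_set n I G)"

text \<open>For $I \neq 0$ and $1 \le k \le n$ both maxima are over finite nonempty sets, since the set of
  minimal generators is finite and nonempty.\<close>

definition alpha :: "nat \<Rightarrow> 'k::field mpoly set \<Rightarrow> nat \<Rightarrow> nat" where
  "alpha n I k = Max {j. \<forall>u\<in>min_gens n I. Var k ^ j divides\<^bsub>poly_ring n\<^esub> u}"

definition beta :: "nat \<Rightarrow> 'k::field mpoly set \<Rightarrow> nat \<Rightarrow> nat" where
  "beta n I k = Max {j. \<exists>u\<in>min_gens n I. Var k ^ j divides\<^bsub>poly_ring n\<^esub> u}"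

text \<open>The $\mathbb{Z}^n$-graded component of $S = K[x_1,\ldots,x_n]$ of degree \<open>a\<close>; only the values
  \<open>a 1, \<dots>, a n\<close> matter.\<close>

definition graded_component :: "nat \<Rightarrow> (nat \<Rightarrow> int) \<Rightarrow> 'k::field mpoly set" where
  "graded_component n a =
     {p \<in> polys {1..n}. \<forall>t\<in>Poly_Mapping.keys p. \<forall>k\<in>{1..n}. int (Poly_Mapping.lookup t k) = a k}"

definition homogeneous :: "nat \<Rightarrow> 'k::field mpoly \<Rightarrow> bool" where
  "homogeneous n p \<longleftrightarrow> (\<exists>a. p \<in> graded_component n a)"

text \<open>Freeness of a module \<open>N\<close> over a subring \<open>R\<close>, both inside the same commutative ring: the
  coefficient families with respect to the basis \<open>B\<close> are the finitely supported maps \<open>c\<close>.\<close>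

definition basis_over :: "'p::comm_ring_1 set \<Rightarrow> 'p set \<Rightarrow> 'p set \<Rightarrow> bool" where
  "basis_over R B N \<longleftrightarrow> B \<subseteq> N \<and>
     (\<forall>p\<in>N. \<exists>!c. Poly_Mapping.keys c \<subseteq> B \<and> (\<forall>b\<in>B. Poly_Mapping.lookup c b \<in> R) \<and>
        p = (\<Sum>b\<in>Poly_Mapping.keys c. Poly_Mapping.lookup c b * b))"

definition free_over :: "'p::comm_ring_1 set \<Rightarrow> 'p set \<Rightarrow> bool" where
  "free_over R N \<longleftrightarrow> (\<exists>B. basis_over R B N)"

definition stanley_space :: "'k::field mpoly \<Rightarrow> nat set \<Rightarrow> 'k mpoly set" where
  "stanley_space m Z = {m * f |f. f \<in> polys Z}"

text \<open>Stanley decompositions of a multigraded submodule \<open>M\<close> of $S$, as lists of pairs $(m_i, Z_i)$.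
  The sum of the subspaces is direct and equal to \<open>M\<close> iff adding up components is a bijection from
  the product of the subspaces onto \<open>M\<close>.\<close>

definition stanley_decomposition ::
    "nat \<Rightarrow> 'k::field mpoly set \<Rightarrow> ('k mpoly \<times> nat set) list \<Rightarrow> bool" where
  "stanley_decomposition n M D \<longleftrightarrow>
     (\<forall>(m, Z)\<in>set D. m \<in> M \<and> homogeneous n m \<and> Z \<subseteq> {1..n} \<and>
        free_over (polys Z) (stanley_space m Z)) \<and>
     bij_betw sum_list (listset (map (\<lambda>(m, Z). stanley_space m Z) D)) M"

definition slength :: "nat \<Rightarrow> 'k::field mpoly set \<Rightarrow> nat" where
  "slength n M = (LEAST r. \<exists>D. stanley_decomposition n M D \<and> length D = r)"

end

theory Submission
  imports Complex_Main Defs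
begin

text \<open>Whether a monomial $x^t$ lies in $I$ depends only on $t_1$ and on the truncations
  $\min(t_k, \beta_k)$ for $k \ge 2$. Among the monomials of $I$ with prescribed truncations choose
  the one, $m$, with least exponent of $x_1$ and with $m_k \le \beta_k$ for $k \ge 2$. The
  monomials of $I$ with these truncations are exactly those of $m K[Z]$, where $Z$ consists of
  $x_1$ and all $x_k$ with $m_k = \beta_k$. As every truncation lies between $\alpha_k$ and
  $\beta_k$, the number of Stanley spaces so obtained is at most the product.\<close>

abbreviation "keys \<equiv> Poly_Mapping.keys"
abbreviation "lookup \<equiv> Poly_Mapping.lookup"
abbreviation "xpow t \<equiv> Poly_Mapping.single t 1"

section \<open>Sets of exponent vectors\<close>

definition divs :: "(nat \<Rightarrow>\<^sub>0 nat) \<Rightarrow> (nat \<Rightarrow>\<^sub>0 nat) \<Rightarrow> bool" (infix "\<preceq>" 50) where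
  "s \<preceq> t \<longleftrightarrow> (\<forall>k. lookup s k \<le> lookup t k)"

definition exponents :: "nat set \<Rightarrow> (nat \<Rightarrow>\<^sub>0 nat) set" where
  "exponents Z = {t. keys t \<subseteq> Z}"

text \<open>If \<open>A\<close> consists of exponents of monomials, these are the exponents of all
  monomials in the ideal they generate. The fixed points \<open>up_set n E = E\<close> encode
  monomial ideals.\<close>

definition up_set :: "nat \<Rightarrow> (nat \<Rightarrow>\<^sub>0 nat) set \<Rightarrow> (nat \<Rightarrow>\<^sub>0 nat) set" where
  "up_set n A = {t \<in> exponents {1..n}. \<exists>a\<in>A. a \<preceq> t}"

text \<open>For the exponent set of a monomial ideal these turn out to be the exponents of G(I), see
  \<open>min_gens_supported\<close>.\<close>

definition minimal_elements :: "(nat \<Rightarrow>\<^sub>0 nat) set \<Rightarrow> (nat \<Rightarrow>\<^sub>0 nat) set" where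
  "minimal_elements E = {t \<in> E. \<forall>s\<in>E. s \<preceq> t \<longrightarrow> s = t}"

lemma exponents_iff: "t \<in> exponents Z \<longleftrightarrow> (\<forall>k. k \<notin> Z \<longrightarrow> lookup t k = 0)"
  by (auto simp: exponents_def in_keys_iff)

lemma divs_refl [simp]: "t \<preceq> t"
  by (simp add: divs_def)

lemma divs_trans: "r \<preceq> s \<Longrightarrow> s \<preceq> t \<Longrightarrow> r \<preceq> t"
  by (auto simp: divs_def intro: order_trans)

lemma divs_add: "s \<preceq> s + t"
  by (simp add: divs_def lookup_add)

lemma divs_add_diff: "s \<preceq> t \<Longrightarrow> s + (t - s) = t"
  by (auto simp: divs_def lookup_add lookup_minus intro!: poly_mapping_eqI)

lemma up_set_absorb: "up_set n (up_set n A) = up_set n A"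
  unfolding up_set_def using divs_trans divs_refl by blast

text \<open>Among the elements of \<open>E\<close> dividing \<open>t\<close> take one of least total
  degree. An element of \<open>E\<close> below it also divides \<open>t\<close>, hence has the same
  degree, and comparable vectors of equal degree coincide.\<close>

lemma minimal_element_below:
  assumes "E \<subseteq> exponents {1..n}" "t \<in> E"
  obtains g where "g \<in> minimal_elements E" "g \<preceq> t"
proof -
  let ?P = "\<lambda>s. s \<in> E \<and> s \<preceq> t" and ?deg = "\<lambda>s. \<Sum>k\<in>{1..n}. lookup s k"
  obtain g where g: "?P g" and least: "\<And>s. ?P s \<Longrightarrow> ?deg g \<le> ?deg s"
    using ex_has_least_nat[of ?P t ?deg] assms(2) by auto
  have "s = g" if "s \<in> E" "s \<preceq> g" for s
  proof -
    have le: "lookup s k \<le> lookup g k" for k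
      using that(2) by (simp add: divs_def)
    have "s \<preceq> t"
      using that(2) g divs_trans by blast
    then have "?deg s = ?deg g"
      using that(1) by (intro le_antisym sum_mono le least) simp
    then have "\<forall>k\<in>{1..n}. lookup s k = lookup g k"
      using sum_mono_inv[of "lookup s" "{1..n}" "lookup g"] le by blast
    moreover have "s \<in> exponents {1..n}" "g \<in> exponents {1..n}"
      using that g assms(1) by auto
    ultimately show "s = g"
      unfolding exponents_iff by (intro poly_mapping_eqI) metis
  qed
  with g that show thesis
    by (auto simp: minimal_elements_def)
qed

lemma up_set_minimal_elements:
  assumes "up_set n E = E"
  shows "up_set n (minimal_elements E) = E"
proof
  show "up_set n (minimal_elements E) \<subseteq> E"
    by (subst (2) assms[symmetric]) (auto simp: up_set_def minimal_elements_def)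
  show "E \<subseteq> up_set n (minimal_elements E)"
  proof
    fix t assume "t \<in> E"
    moreover have "E \<subseteq> exponents {1..n}"
      using assms by (auto simp: up_set_def)
    moreover obtain g where "g \<in> minimal_elements E" "g \<preceq> t"
      using minimal_element_below calculation by metis
    ultimately show "t \<in> up_set n (minimal_elements E)"
      by (auto simp: up_set_def)
  qed
qed

text \<open>Some \<open>a\<close> in \<open>A\<close> lies below a given minimal element and itself
  belongs to the up-set, so minimality makes the two equal. Uniqueness of the minimal generating set
  rests on this.\<close>

lemma minimal_elements_subset_generators:
  assumes "A \<subseteq> exponents {1..n}"
  shows "minimal_elements (up_set n A) \<subseteq> A"
proof
  fix t assume t: "t \<in> minimal_elements (up_set n A)"
  then obtain a where a: "a \<in> A" "a \<preceq> t"
    by (auto simp: minimal_elements_def up_set_def)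
  then have "a \<in> up_set n A"
    using assms by (auto simp: up_set_def intro!: bexI[of _ a])
  with t a show "t \<in> A"
    by (auto simp: minimal_elements_def)
qed

section \<open>Dickson's lemma\<close>

text \<open>A weakly decreasing sequence of naturals is constant from the point where it attains its
  least value, so dropping an initial segment makes it nondecreasing.\<close>

lemma mono_subseq_nat:
  fixes s :: "nat \<Rightarrow> nat"
  obtains r :: "nat \<Rightarrow> nat" where "strict_mono r" "mono (\<lambda>i. s (r i))"
proof -
  obtain r :: "nat \<Rightarrow> nat" where r: "strict_mono r" "monoseq (\<lambda>i. s (r i))"
    using seq_monosub[of s] by blast
  show thesis
  proof (cases "incseq (\<lambda>i. s (r i))")
    case True
    with r that show thesis by (simp add: incseq_def mono_def)
  next
    case False
    with r have dec: "\<And>i j. i \<le> j \<Longrightarrow> s (r j) \<le> s (r i)"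
      by (auto simp: monoseq_iff decseq_def)
    obtain N where N: "\<And>i. s (r N) \<le> s (r i)"
      using ex_has_least_nat[of "\<lambda>_. True" 0 "\<lambda>i. s (r i)"] by auto
    have "s (r (i + N)) = s (r N)" for i
      using dec[of N "i + N"] N[of "i + N"] by simp
    then have "mono (\<lambda>i. s (r (i + N)))"
      by (simp add: mono_def)
    moreover have "strict_mono (\<lambda>i. r (i + N))"
      using r(1) by (simp add: strict_mono_def)
    ultimately show thesis
      by (rule that[rotated])
  qed
qed

text \<open>One coordinate at a time: passing to a further subsequence preserves the monotonicity
  already obtained.\<close>

lemma mono_subseq_finite:
  fixes s :: "nat \<Rightarrow> 'a \<Rightarrow> nat"
  assumes "finite Z"
  shows "\<exists>r :: nat \<Rightarrow> nat. strict_mono r \<and> (\<forall>k\<in>Z. mono (\<lambda>i. s (r i) k))"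
  using assms
proof induction
  case empty
  show ?case by (intro exI[of _ id]) (simp add: strict_mono_def)
next
  case (insert z Z)
  then obtain r :: "nat \<Rightarrow> nat" where r: "strict_mono r" "\<And>k. k \<in> Z \<Longrightarrow> mono (\<lambda>i. s (r i) k)"
    by blast
  obtain q :: "nat \<Rightarrow> nat" where q: "strict_mono q" "mono (\<lambda>i. s (r (q i)) z)"
    using mono_subseq_nat[of "\<lambda>i. s (r i) z"] by blast
  have "mono (\<lambda>i. s (r (q i)) k)" if "k \<in> Z" for k
    using r(2)[OF that] strict_mono_mono[OF q(1)] by (simp add: mono_def)
  with q r(1) show ?case
    by (intro exI[of _ "\<lambda>i. r (q i)"]) (auto simp: strict_mono_def)
qed

text \<open>Infinitely many minimal elements would give a sequence of distinct ones. A subsequence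
  nondecreasing in all n coordinates has comparable terms, which minimality makes equal.\<close>

lemma finite_minimal_elements:
  assumes "E \<subseteq> exponents {1..n}"
  shows "finite (minimal_elements E)"
proof (rule ccontr)
  assume "infinite (minimal_elements E)"
  then obtain f :: "nat \<Rightarrow> _" where f: "inj f" "range f \<subseteq> minimal_elements E"
    using infinite_countable_subset by blast
  obtain r :: "nat \<Rightarrow> nat" where r: "strict_mono r" "\<forall>k\<in>{1..n}. mono (\<lambda>i. lookup (f (r i)) k)"
    using mono_subseq_finite[of "{1..n}" "\<lambda>i. lookup (f i)"] by auto
  have min: "f i \<in> minimal_elements E" for i
    using f(2) by auto
  then have "f i \<in> exponents {1..n}" for i
    using assms by (auto simp: minimal_elements_def)
  \<comment> \<open>At indices outside \<open>{1..n}\<close> both vectors vanish.\<close>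
  then have "f (r 0) \<preceq> f (r 1)"
    using r(2) unfolding divs_def mono_def exponents_iff
    by (metis order_refl zero_le_one)
  then have "f (r 0) = f (r 1)"
    using min[of "r 0"] min[of "r 1"] by (auto simp: minimal_elements_def)
  then have "r 0 = r 1"
    using f(1) by (simp add: inj_eq)
  with r(1) show False
    by (metis strict_mono_eq zero_neq_one)
qed

section \<open>Monomial ideals\<close>

text \<open>The \<open>K\<close>-span of the monomials with exponents in \<open>E\<close>.
  Polynomial rings K[Z], monomial ideals and monomial Stanley spaces all have this form, so
  statements about them reduce to sets of exponents.\<close>

definition supported :: "(nat \<Rightarrow>\<^sub>0 nat) set \<Rightarrow> 'k::field mpoly set" where
  "supported E = {p. keys p \<subseteq> E}"

lemma polys_eq_supported: "polys Z = supported (exponents Z)"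
  by (auto simp: polys_def supported_def exponents_def)

lemma monomials_eq_image: "monomials n = xpow ` exponents {1..n}"
  by (auto simp: monomials_def exponents_def)

lemma xpow_in_supported_iff [simp]: "xpow t \<in> supported E \<longleftrightarrow> t \<in> E"
  by (simp add: supported_def)

lemma supported_zero: "0 \<in> supported E"
  by (simp add: supported_def)

lemma supported_add: "p \<in> supported E \<Longrightarrow> q \<in> supported E \<Longrightarrow> p + q \<in> supported E"
  using keys_add[of p q] by (auto simp: supported_def)

lemma supported_uminus: "p \<in> supported E \<Longrightarrow> - p \<in> supported E"
  by (auto simp: supported_def in_keys_iff)

lemma supported_mult:
  assumes "p \<in> supported E" "q \<in> supported F" "\<And>s t. s \<in> E \<Longrightarrow> t \<in> F \<Longrightarrow> s + t \<in> G"
  shows "p * q \<in> supported G"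
  using assms keys_mult[of p q] by (fastforce simp: supported_def)

lemma exponents_add: "s \<in> exponents Z \<Longrightarrow> t \<in> exponents Z \<Longrightarrow> s + t \<in> exponents Z"
  by (auto simp: exponents_iff lookup_add)

lemma mpoly_eq_sum_terms: "p = (\<Sum>t\<in>keys p. Poly_Mapping.single t (lookup p t))"
  by (rule poly_mapping_eqI)
     (auto simp: lookup_sum lookup_single when_def sum.delta in_keys_iff)

lemma polys_mult: "p \<in> polys Z \<Longrightarrow> q \<in> polys Z \<Longrightarrow> p * q \<in> polys Z"
  unfolding polys_eq_supported by (erule supported_mult) (auto intro: exponents_add)

lemma one_in_polys: "1 \<in> polys Z"
  by (simp add: polys_def)

section \<open>Ideals generated by monomials\<close>

lemma cring_poly_ring: "cring (poly_ring n :: 'k::field mpoly ring)"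
proof (rule cringI)
  show "abelian_group (poly_ring n :: 'k mpoly ring)"
    by (rule abelian_groupI)
       (auto simp: poly_ring_def polys_eq_supported supported_add supported_zero add.assoc add.commute
         intro: bexI[OF _ supported_uminus])
  show "comm_monoid (poly_ring n :: 'k mpoly ring)"
    by (rule comm_monoidI)
       (auto simp: poly_ring_def polys_mult one_in_polys mult.assoc mult.commute)
qed (auto simp: poly_ring_def distrib_right)

lemma ideal_supported_up_set:
  "ideal (supported (up_set n A) :: 'k::field mpoly set) (poly_ring n)"
proof -
  interpret cring "poly_ring n :: 'k mpoly ring" by (rule cring_poly_ring)
  have sub: "(supported (up_set n A) :: 'k mpoly set) \<subseteq> carrier (poly_ring n)"
    by (auto simp: poly_ring_def polys_eq_supported supported_def up_set_def)
  have up: "s + t \<in> up_set n A" if "s \<in> exponents {1..n}" "t \<in> up_set n A" for s t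
    using that divs_trans[OF _ divs_add[of t s]]
    by (auto simp: up_set_def exponents_add add.commute)
  have mult: "x * a \<in> supported (up_set n A)"
    if "a \<in> supported (up_set n A)" "x \<in> polys {1..n}" for a x :: "'k mpoly"
    using that by (auto simp: polys_eq_supported intro: supported_mult[OF _ _ up])
  show ?thesis
  proof (rule idealI)
    show "subgroup (supported (up_set n A)) (add_monoid (poly_ring n :: 'k mpoly ring))"
    proof (rule add.subgroupI)
      fix a :: "'k mpoly" assume a: "a \<in> supported (up_set n A)"
      then have "\<ominus>\<^bsub>poly_ring n\<^esub> a = - a"
        using sub by (intro minus_equality)
          (auto simp: poly_ring_def polys_eq_supported intro: supported_uminus)
      with a show "\<ominus>\<^bsub>poly_ring n\<^esub> a \<in> supported (up_set n A)"
        by (simp add: supported_uminus)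
    next
      show "supported (up_set n A) \<noteq> ({} :: 'k mpoly set)"
        using supported_zero by blast
    qed (use sub supported_add in \<open>auto simp: poly_ring_def\<close>)
    show "x \<otimes>\<^bsub>poly_ring n\<^esub> a \<in> supported (up_set n A)" "a \<otimes>\<^bsub>poly_ring n\<^esub> x \<in> supported (up_set n A)"
      if "a \<in> supported (up_set n A)" "x \<in> carrier (poly_ring n)" for a x :: "'k mpoly"
      using mult[of a x] that by (simp_all add: poly_ring_def mult.commute)
  qed (rule ring_axioms)
qed

text \<open>The right side is an ideal containing the generators. Conversely, each term of one of
  its elements is a multiple of some x^a with \<open>a\<close> in \<open>A\<close>, and a polynomial
  is the sum of its terms.\<close>

lemma genideal_monomials:
  assumes "A \<subseteq> exponents {1..n}"
  shows "Idl\<^bsub>poly_ring n\<^esub> (xpow ` A) = (supported (up_set n A) :: 'k::field mpoly set)"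
proof
  interpret cring "poly_ring n :: 'k mpoly ring" by (rule cring_poly_ring)
  show "Idl\<^bsub>poly_ring n\<^esub> (xpow ` A) \<subseteq> (supported (up_set n A) :: 'k mpoly set)"
  proof (rule genideal_minimal[OF ideal_supported_up_set])
    show "xpow ` A \<subseteq> (supported (up_set n A) :: 'k mpoly set)"
    proof clarsimp
      fix t assume "t \<in> A"
      with assms divs_refl[of t] show "t \<in> up_set n A"
        unfolding up_set_def by blast
    qed
  qed
  let ?J = "Idl\<^bsub>poly_ring n\<^esub> (xpow ` A) :: 'k mpoly set"
  have gens: "xpow ` A \<subseteq> (carrier (poly_ring n) :: 'k mpoly set)"
    using assms by (auto simp: poly_ring_def polys_eq_supported)
  interpret J: ideal ?J "poly_ring n"
    using gens by (rule genideal_ideal)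
  have single_in: "Poly_Mapping.single t c \<in> ?J" if t: "t \<in> up_set n A" for t and c :: 'k
  proof -
    obtain a where a: "a \<in> A" "a \<preceq> t"
      using t by (auto simp: up_set_def)
    have "t \<in> exponents {1..n}"
      using t by (auto simp: up_set_def)
    \<comment> \<open>The scalar is carried by the cofactor, so closure under ring multiplication
      covers it.\<close>
    then have "Poly_Mapping.single (t - a) c \<in> carrier (poly_ring n)"
      by (auto simp: poly_ring_def polys_eq_supported supported_def exponents_iff lookup_minus)
    moreover have "xpow a \<in> ?J"
      using a genideal_self[OF gens] by auto
    ultimately have "xpow a * Poly_Mapping.single (t - a) c \<in> ?J"
      using J.I_r_closed by (fastforce simp: poly_ring_def)
    with divs_add_diff[OF a(2)] show ?thesis
      by (simp add: mult_single)
  qed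
  have sum_in: "sum f T \<in> ?J" if "finite T" "\<And>t. t \<in> T \<Longrightarrow> f t \<in> ?J"
    for T and f :: "(nat \<Rightarrow>\<^sub>0 nat) \<Rightarrow> 'k mpoly"
    using that
  proof induction
    case empty
    show ?case using J.zero_closed by (simp add: poly_ring_def)
  next
    case (insert t T)
    then show ?case using J.a_closed[of "f t" "sum f T"] by (simp add: poly_ring_def)
  qed
  show "supported (up_set n A) \<subseteq> ?J"
  proof
    fix p :: "'k mpoly" assume "p \<in> supported (up_set n A)"
    then show "p \<in> ?J"
      by (subst mpoly_eq_sum_terms) (auto simp: supported_def intro!: sum_in single_in)
  qed
qed

section \<open>Minimal monomial generators\<close>

lemma supported_eq_iff: "(supported E :: 'k::field mpoly set) = supported F \<longleftrightarrow> E = F"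
  by (metis xpow_in_supported_iff subsetI subset_antisym)

text \<open>Every generating set of monomials contains the monomials of the minimal elements, and
  these already generate. So they form the only irredundant one, which makes the definite
  description in \<open>min_gens\<close> meaningful.\<close>

lemma minimal_monomial_generating_set_iff:
  assumes "up_set n E = E"
  shows "minimal_monomial_generating_set n (supported E) G \<longleftrightarrow>
    (G :: 'k::field mpoly set) = xpow ` minimal_elements E"
proof -
  let ?M = "minimal_elements E"
  have E: "E \<subseteq> exponents {1..n}"
    using assms by (auto simp: up_set_def)
  then have M: "?M \<subseteq> exponents {1..n}"
    by (auto simp: minimal_elements_def)
  have gen: "Idl\<^bsub>poly_ring n\<^esub> (xpow ` ?M) = (supported E :: 'k mpoly set)"
    using genideal_monomials[OF M] up_set_minimal_elements[OF assms] by simp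
  have contains: "xpow ` ?M \<subseteq> H"
    if H: "H \<subseteq> monomials n" "Idl\<^bsub>poly_ring n\<^esub> H = supported E" for H :: "'k mpoly set"
  proof -
    obtain A where A: "A \<subseteq> exponents {1..n}" "H = xpow ` A"
      using H(1) by (auto simp: monomials_eq_image subset_image_iff)
    then have "up_set n A = E"
      using H(2) genideal_monomials[OF A(1), where 'k = 'k] by (simp add: supported_eq_iff)
    with minimal_elements_subset_generators[OF A(1)] A(2) show ?thesis
      by auto
  qed
  show ?thesis
  proof
    assume G: "minimal_monomial_generating_set n (supported E) G"
    then have "xpow ` ?M \<subseteq> G"
      by (intro contains) (auto simp: minimal_monomial_generating_set_def)
    with G gen show "G = xpow ` ?M"
      unfolding minimal_monomial_generating_set_def psubset_eq by blast
  next
    assume G: "G = xpow ` ?M"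
    with M have "G \<subseteq> monomials n"
      by (auto simp: monomials_eq_image)
    moreover have "Idl\<^bsub>poly_ring n\<^esub> H \<noteq> supported E" if "H \<subset> G" for H
      using that contains[of H] calculation G by blast
    ultimately show "minimal_monomial_generating_set n (supported E) G"
      using gen G by (auto simp: minimal_monomial_generating_set_def)
  qed
qed

lemma min_gens_supported:
  assumes "up_set n E = E"
  shows "min_gens n (supported E :: 'k::field mpoly set) = xpow ` minimal_elements E"
  unfolding min_gens_def minimal_monomial_generating_set_iff[OF assms] by simp

section \<open>Divisibility by powers of a variable; the numbers \<alpha>_k and \<beta>_k\<close>

lemma Var_power: "(Var k :: 'k::field mpoly) ^ j = xpow (Poly_Mapping.single k j)"
proof (induction j)
  case (Suc j)
  then show ?case
    using single_add[of k 1 j] by (simp add: Var_def mult_single)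
qed simp

lemma Var_power_divides_xpow_iff:
  assumes "t \<in> exponents {1..n}"
  shows "(Var k ^ j :: 'k::field mpoly) divides\<^bsub>poly_ring n\<^esub> xpow t \<longleftrightarrow> j \<le> lookup t k"
proof
  assume "(Var k ^ j :: 'k mpoly) divides\<^bsub>poly_ring n\<^esub> xpow t"
  then obtain q :: "'k mpoly" where "xpow t = xpow (Poly_Mapping.single k j) * q"
    by (auto simp: factor_def poly_ring_def Var_power)
  \<comment> \<open>The cofactor \<open>q\<close> is not known to be a monomial; comparing supports
    still yields a term of \<open>q\<close> whose exponent completes that of the variable power to
    \<open>t\<close>.\<close>
  then have "keys (xpow t :: 'k mpoly) \<subseteq> {Poly_Mapping.single k j + s | s. s \<in> keys q}"
    using keys_mult[of "xpow (Poly_Mapping.single k j)" q] by auto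
  then obtain s where "t = Poly_Mapping.single k j + s"
    by auto
  then show "j \<le> lookup t k"
    by (simp add: lookup_add)
next
  let ?e = "Poly_Mapping.single k j"
  assume "j \<le> lookup t k"
  then have "?e \<preceq> t"
    by (auto simp: divs_def lookup_single when_def)
  then have "(xpow t :: 'k mpoly) = Var k ^ j * xpow (t - ?e)"
    by (simp add: Var_power mult_single divs_add_diff)
  moreover have "xpow (t - ?e) \<in> polys {1..n}"
    using assms by (auto simp: polys_eq_supported exponents_iff lookup_minus)
  ultimately show "(Var k ^ j :: 'k mpoly) divides\<^bsub>poly_ring n\<^esub> xpow t"
    by (auto simp: factor_def poly_ring_def)
qed

text \<open>A minimal element below \<open>t\<close> serves twice: it bounds the admissible
  \<open>j\<close>, so that the maximum is itself admissible, and it carries the bound from the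
  generators over to \<open>t\<close>.\<close>

lemma alpha_le_lookup:
  assumes "up_set n E = E" "t \<in> E"
  shows "alpha n (supported E :: 'k::field mpoly set) k \<le> lookup t k"
proof -
  let ?M = "minimal_elements E"
  have E: "E \<subseteq> exponents {1..n}"
    using assms by (auto simp: up_set_def)
  then have "(Var k ^ j :: 'k mpoly) divides\<^bsub>poly_ring n\<^esub> xpow g \<longleftrightarrow> j \<le> lookup g k"
    if "g \<in> ?M" for g j
    using that by (intro Var_power_divides_xpow_iff) (auto simp: minimal_elements_def)
  then have alpha: "alpha n (supported E :: 'k mpoly set) k = Max {j. \<forall>g\<in>?M. j \<le> lookup g k}"
    by (auto simp: alpha_def min_gens_supported[OF assms(1)] intro!: arg_cong[of _ _ Max])
  obtain g where g: "g \<in> ?M" "g \<preceq> t"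
    using minimal_element_below[OF E assms(2)] .
  have "Max {j. \<forall>g\<in>?M. j \<le> lookup g k} \<in> {j. \<forall>g\<in>?M. j \<le> lookup g k}"
  proof (rule Max_in)
    show "finite {j. \<forall>g\<in>?M. j \<le> lookup g k}"
      by (rule finite_subset[of _ "{..lookup g k}"]) (use g in auto)
    show "{j. \<forall>g\<in>?M. j \<le> lookup g k} \<noteq> {}"
      by (auto intro: exI[of _ 0])
  qed
  with g alpha show ?thesis
    by (auto simp: divs_def intro: order_trans)
qed

text \<open>Dickson's lemma enters here: the set under the maximum is a finite union of initial
  segments, so the maximum bounds all its members.\<close>

lemma lookup_le_beta:
  assumes "up_set n E = E" "g \<in> minimal_elements E"
  shows "lookup g k \<le> beta n (supported E :: 'k::field mpoly set) k"
proof -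
  let ?M = "minimal_elements E"
  have E: "E \<subseteq> exponents {1..n}"
    using assms by (auto simp: up_set_def)
  then have "(Var k ^ j :: 'k mpoly) divides\<^bsub>poly_ring n\<^esub> xpow g \<longleftrightarrow> j \<le> lookup g k"
    if "g \<in> ?M" for g j
    using that by (intro Var_power_divides_xpow_iff) (auto simp: minimal_elements_def)
  then have beta: "beta n (supported E :: 'k mpoly set) k = Max (\<Union>g\<in>?M. {..lookup g k})"
    by (auto simp: beta_def min_gens_supported[OF assms(1)] intro!: arg_cong[of _ _ Max])
  have "finite (\<Union>g\<in>?M. {..lookup g k})"
    using finite_minimal_elements[OF E] by simp
  then show ?thesis
    unfolding beta using assms(2) by (intro Max_ge) auto
qed

section \<open>Stanley decompositions of monomial subspaces\<close>

lemma stanley_space_xpow: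
  "stanley_space (xpow r) Z = (supported ((+) r ` exponents Z) :: 'k::field mpoly set)"
proof
  show "stanley_space (xpow r) Z \<subseteq> (supported ((+) r ` exponents Z) :: 'k mpoly set)"
    by (auto simp: stanley_space_def polys_eq_supported intro: supported_mult[of _ "{r}" _ "exponents Z"])
  show "(supported ((+) r ` exponents Z) :: 'k mpoly set) \<subseteq> stanley_space (xpow r) Z"
  proof
    fix p :: "'k mpoly" assume p: "p \<in> supported ((+) r ` exponents Z)"
    \<comment> \<open>Divides \<open>p\<close> by x^r term by term. Every exponent of
      \<open>p\<close> has the form \<open>r + s\<close>, so the cutoff subtraction is
      exact.\<close>
    let ?q = "\<Sum>t\<in>keys p. Poly_Mapping.single (t - r) (lookup p t)"
    have keys_p: "r + (t - r) = t" "t - r \<in> exponents Z" if "t \<in> keys p" for t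
      using p that by (auto simp: supported_def)
    have "xpow r * ?q = (\<Sum>t\<in>keys p. Poly_Mapping.single t (lookup p t))"
      unfolding sum_distrib_left by (rule sum.cong) (auto simp: mult_single keys_p)
    then have "p = xpow r * ?q"
      using mpoly_eq_sum_terms[of p] by simp
    moreover have "?q \<in> supported (exponents Z)"
    proof -
      have "sum f T \<in> supported F" if "finite T" "\<And>t. t \<in> T \<Longrightarrow> f t \<in> supported F"
        for T F and f :: "(nat \<Rightarrow>\<^sub>0 nat) \<Rightarrow> 'k mpoly"
        using that by induction (auto simp: supported_zero supported_add)
      then show ?thesis
        using keys_p by (auto simp: supported_def)
    qed
    ultimately show "p \<in> stanley_space (xpow r) Z"
      by (auto simp: stanley_space_def polys_eq_supported)
  qed
qed

text \<open>The polynomial ring is a domain, so \<open>m\<close> alone is a basis: its coefficient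
  is recovered by cancelling \<open>m\<close>.\<close>

lemma free_over_stanley_space:
  fixes m :: "'k::field mpoly"
  assumes "m \<noteq> 0"
  shows "free_over (polys Z) (stanley_space m Z)"
proof -
  \<comment> \<open>If \<open>m\<close> is not a key of \<open>c\<close>, the sum is empty and the
    coefficient on the right is 0.\<close>
  have sum_keys: "(\<Sum>b\<in>keys c. lookup c b * b) = lookup c m * m"
    if "keys c \<subseteq> {m}" for c :: "'k mpoly \<Rightarrow>\<^sub>0 'k mpoly"
    using that by (cases "keys c = {}") (auto simp: subset_singleton_iff in_keys_iff)
  have "\<exists>!c. keys c \<subseteq> {m} \<and> (\<forall>b\<in>{m}. lookup c b \<in> polys Z) \<and>
      p = (\<Sum>b\<in>keys c. lookup c b * b)" if p: "p \<in> stanley_space m Z" for p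
  proof -
    obtain f where f: "f \<in> polys Z" "p = m * f"
      using p by (auto simp: stanley_space_def)
    show ?thesis
    proof (rule ex1I[of _ "Poly_Mapping.single m f"])
      show "keys (Poly_Mapping.single m f) \<subseteq> {m} \<and>
          (\<forall>b\<in>{m}. lookup (Poly_Mapping.single m f) b \<in> polys Z) \<and>
          p = (\<Sum>b\<in>keys (Poly_Mapping.single m f). lookup (Poly_Mapping.single m f) b * b)"
        using f by (auto simp: mult.commute)
    next
      fix c assume c: "keys c \<subseteq> {m} \<and> (\<forall>b\<in>{m}. lookup c b \<in> polys Z) \<and>
          p = (\<Sum>b\<in>keys c. lookup c b * b)"
      then have "lookup c m * m = f * m"
        using f sum_keys by (simp add: mult.commute)
      then have "lookup c m = f"
        using assms by simp
      moreover have "lookup c b = 0" if "b \<noteq> m" for b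
        using c that by (meson not_in_keys_iff_lookup_eq_zero singletonD subsetD)
      ultimately show "c = Poly_Mapping.single m f"
        by (intro poly_mapping_eqI) (auto simp: lookup_single when_def)
    qed
  qed
  moreover have "m \<in> stanley_space m Z"
    by (auto simp: stanley_space_def polys_def intro!: exI[of _ 1])
  ultimately have "basis_over (polys Z) {m} (stanley_space m Z)"
    by (auto simp: basis_over_def)
  then show ?thesis
    by (auto simp: free_over_def)
qed

lemma homogeneous_xpow:
  assumes "t \<in> exponents {1..n}"
  shows "homogeneous n (xpow t :: 'k::field mpoly)"
  unfolding homogeneous_def graded_component_def
  by (rule exI[of _ "\<lambda>k. int (lookup t k)"]) (use assms in \<open>auto simp: polys_def exponents_def\<close>)

text \<open>For disjoint exponent sets each coefficient of a sum comes from one summand only, and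
  the summands are recovered by restricting the support.\<close>

lemma bij_betw_add_supported:
  assumes "E \<inter> F = {}"
  shows "bij_betw (\<lambda>(p, q). p + q) (supported E \<times> supported F)
    (supported (E \<union> F) :: 'k::field mpoly set)"
proof (rule bij_betwI')
  fix x y :: "'k mpoly \<times> 'k mpoly"
  assume "x \<in> supported E \<times> supported F" "y \<in> supported E \<times> supported F"
  then obtain p q p' q' where xy: "x = (p, q)" "y = (p', q')"
    and p: "p \<in> supported E" "p' \<in> supported E" and q: "q \<in> supported F" "q' \<in> supported F"
    by auto
  have "p = p'" if "p + q = p' + q'"
  proof (rule poly_mapping_eqI)
    fix t
    have "lookup p t + lookup q t = lookup p' t + lookup q' t"
      using that by (metis lookup_add)
    moreover have "t \<notin> E \<or> t \<notin> F"
      using assms by auto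
    moreover have "t \<notin> E \<Longrightarrow> lookup p t = 0 \<and> lookup p' t = 0"
      "t \<notin> F \<Longrightarrow> lookup q t = 0 \<and> lookup q' t = 0"
      using p q by (auto simp: supported_def in_keys_iff)
    ultimately show "lookup p t = lookup p' t"
      by auto
  qed
  then show "((\<lambda>(p, q). p + q) x = (\<lambda>(p, q). p + q) y) = (x = y)"
    by (auto simp: xy)
next
  fix x :: "'k mpoly \<times> 'k mpoly"
  assume "x \<in> supported E \<times> supported F"
  then show "(\<lambda>(p, q). p + q) x \<in> supported (E \<union> F)"
    using keys_add by (fastforce simp: supported_def)
next
  fix p :: "'k mpoly"
  assume p: "p \<in> supported (E \<union> F)"
  let ?res = "\<lambda>G. Poly_Mapping.mapp (\<lambda>t c. c when t \<in> G) p"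
  have lookup_res: "lookup (?res G) t = (if t \<in> G then lookup p t else 0)" for G t
    by (auto simp: lookup_mapp when_def in_keys_iff)
  have "p = ?res E + ?res F"
    using p assms
    by (intro poly_mapping_eqI) (auto simp: lookup_add lookup_res supported_def in_keys_iff)
  moreover have "?res G \<in> supported G" for G
    by (auto simp: supported_def in_keys_iff lookup_res split: if_splits)
  ultimately show "\<exists>x\<in>supported E \<times> supported F. p = (\<lambda>(p, q). p + q) x"
    by (intro bexI[of _ "(?res E, ?res F)"]) auto
qed

text \<open>Induction on the list: identify a nonempty list with the pair of head and tail, sum the
  tail by the induction hypothesis, then add by \<open>bij_betw_add_supported\<close>.\<close>

lemma bij_betw_sum_list_supported:
  assumes "distinct rs" "disjoint_family_on C (set rs)"
  shows "bij_betw sum_list (listset (map (\<lambda>r. supported (C r)) rs))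
    (supported (\<Union>r\<in>set rs. C r) :: 'k::field mpoly set)"
  using assms
proof (induction rs)
  case Nil
  then show ?case by (auto simp: bij_betw_def supported_def)
next
  case (Cons r rs)
  let ?L = "listset (map (\<lambda>r. supported (C r)) rs) :: 'k mpoly list set"
  let ?F = "\<Union>r\<in>set rs. C r"
  have IH: "bij_betw sum_list ?L (supported ?F)"
    using Cons by (auto simp: disjoint_family_on_def)
  have "C r \<inter> ?F = {}"
    using Cons.prems by (auto simp: disjoint_family_on_def)
  then have "bij_betw ((\<lambda>(p, q). p + q) \<circ> map_prod id sum_list) (supported (C r) \<times> ?L)
      (supported (C r \<union> ?F))"
    by (intro bij_betw_trans[OF bij_betw_map_prod[OF bij_betw_id IH] bij_betw_add_supported])
  moreover have "bij_betw (\<lambda>xs. (hd xs, tl xs)) (set_Cons (supported (C r)) ?L)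
      (supported (C r) \<times> ?L)"
    by (rule bij_betw_byWitness[where f' = "\<lambda>(x, xs). x # xs"]) (auto simp: set_Cons_def)
  ultimately have "bij_betw (((\<lambda>(p, q). p + q) \<circ> map_prod id sum_list) \<circ> (\<lambda>xs. (hd xs, tl xs)))
      (set_Cons (supported (C r)) ?L) (supported (C r \<union> ?F))"
    by (rule bij_betw_trans[rotated])
  then have "bij_betw sum_list (set_Cons (supported (C r)) ?L) (supported (C r \<union> ?F))"
    \<comment> \<open>The composite is only known to agree with \<open>sum_list\<close> on nonempty
      lists, and all members of \<open>set_Cons\<close> are nonempty.\<close>
    by (rule bij_betw_cong[THEN iffD1, rotated]) (auto simp: set_Cons_def)
  then show ?case
    by simp
qed

text \<open>A partition of the exponents into translated cones, one with apex \<open>r\<close> for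
  each \<open>r\<close> in \<open>R\<close>, is a Stanley decomposition with \<open>card R\<close>
  summands. What remains is combinatorics of exponents.\<close>

lemma slength_supported_le:
  assumes "finite R" and "E \<subseteq> exponents {1..n}" and "\<And>r. r \<in> R \<Longrightarrow> Z r \<subseteq> {1..n}"
    and "disjoint_family_on (\<lambda>r. (+) r ` exponents (Z r)) R"
    and "(\<Union>r\<in>R. (+) r ` exponents (Z r)) = E"
  shows "slength n (supported E :: 'k::field mpoly set) \<le> card R"
proof -
  obtain rs where rs: "set rs = R" "distinct rs"
    using finite_distinct_list[OF assms(1)] by blast
  let ?D = "map (\<lambda>r. (xpow r :: 'k mpoly, Z r)) rs"
  have "R \<subseteq> E"
  proof
    fix r assume "r \<in> R"
    \<comment> \<open>The apex belongs to its own cone, so each chosen monomial lies in the space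
      being decomposed.\<close>
    moreover have "r = r + 0" "0 \<in> exponents (Z r)"
      by (simp_all add: exponents_iff)
    ultimately show "r \<in> E"
      using assms(5) by blast
  qed
  moreover have "bij_betw sum_list (listset (map (\<lambda>(m, Z). stanley_space m Z) ?D))
      (supported E :: 'k mpoly set)"
    using bij_betw_sum_list_supported[OF rs(2), of "\<lambda>r. (+) r ` exponents (Z r)"] assms(4,5) rs(1)
    by (simp add: comp_def stanley_space_xpow)
  moreover have "(xpow r :: 'k mpoly) \<noteq> 0" for r
    by (metis keys_single keys_zero one_neq_zero insert_not_empty)
  ultimately have "stanley_decomposition n (supported E) ?D"
    using assms(2,3) rs(1)
    by (fastforce simp: stanley_decomposition_def intro: homogeneous_xpow free_over_stanley_space)
  moreover have "length ?D = card R"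
    using rs distinct_card by fastforce
  ultimately show ?thesis
    unfolding slength_def by (intro Least_le) blast
qed

section \<open>Truncated exponent vectors\<close>

text \<open>Here \<open>b\<close> is any bound on the exponents of the minimal elements.
  \<open>R\<close> has exactly one member for each truncation that occurs, as the least exponent of
  x_1 singles it out. Leaving x_1 untruncated is why the final product starts at 2.\<close>

lemma truncation_decomposition:
  fixes b :: "nat \<Rightarrow> nat"
  assumes up: "up_set n E = E"
    and bound: "\<And>g k. g \<in> minimal_elements E \<Longrightarrow> lookup g k \<le> b k"
  defines "R \<equiv> {r \<in> E. (\<forall>k\<in>{2..n}. lookup r k \<le> b k) \<and>
      (\<forall>s\<in>E. (\<forall>k\<in>{2..n}. lookup s k = lookup r k) \<longrightarrow> lookup r 1 \<le> lookup s 1)}"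
    and "Z \<equiv> \<lambda>r. {k \<in> {1..n}. k = 1 \<or> b k \<le> lookup r k}"
  shows "disjoint_family_on (\<lambda>r. (+) r ` exponents (Z r)) R"
    and "(\<Union>r\<in>R. (+) r ` exponents (Z r)) = E"
    and "inj_on (\<lambda>r. restrict (lookup r) {2..n}) R"
proof -
  have E: "E \<subseteq> exponents {1..n}"
    using up by (auto simp: up_set_def)
  have up_closed: "t \<in> E" if "s \<in> E" "s \<preceq> t" "t \<in> exponents {1..n}" for s t
    using that up by (auto simp: up_set_def)
  \<comment> \<open>Members of \<open>R\<close> agreeing in coordinates 2 to n compete for the least
    exponent of x_1, so each is at most the other there; outside \<open>{1..n}\<close> both
    vanish.\<close>
  have R_eqI: "r = s" if "r \<in> R" "s \<in> R" "\<And>k. k \<in> {2..n} \<Longrightarrow> lookup r k = lookup s k" for r s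
  proof (rule poly_mapping_eqI)
    fix k
    have rs: "r \<in> E" "s \<in> E" "lookup r 1 \<le> lookup s 1" "lookup s 1 \<le> lookup r 1"
      using that by (simp_all add: R_def)
    consider "k \<in> {2..n}" | "k = 1" | "k \<notin> {1..n}"
      by force
    then show "lookup r k = lookup s k"
    proof cases
      case 3
      moreover have "r \<in> exponents {1..n}" "s \<in> exponents {1..n}"
        using rs E by auto
      ultimately show ?thesis
        by (metis exponents_iff)
    qed (use that rs in simp_all)
  qed
  show "inj_on (\<lambda>r. restrict (lookup r) {2..n}) R"
  proof (rule inj_onI)
    fix r s
    assume rs: "r \<in> R" "s \<in> R" "restrict (lookup r) {2..n} = restrict (lookup s) {2..n}"
    show "r = s"
      by (rule R_eqI[OF rs(1,2)]) (use rs(3) in \<open>metis restrict_apply'\<close>)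
  qed
  \<comment> \<open>For \<open>k\<close> at least 2, multiplying by K[Z r] raises coordinate
    \<open>k\<close> only if it has already reached \<open>b k\<close>, so truncating undoes
    it.\<close>
  have truncation: "lookup r k = min (lookup t k) (b k)"
    if r: "r \<in> R" and t: "t \<in> (+) r ` exponents (Z r)" and k: "k \<in> {2..n}" for r t k
  proof -
    obtain s where s: "t = r + s" "s \<in> exponents (Z r)"
      using t by auto
    have le: "lookup r k \<le> b k"
      using r k by (simp add: R_def)
    show ?thesis
    proof (cases "k \<in> Z r")
      case True
      with k have "b k \<le> lookup r k"
        by (auto simp: Z_def)
      with le show ?thesis by (simp add: s(1) lookup_add)
    next
      case False
      with s(2) have "lookup s k = 0"
        unfolding exponents_iff by blast
      with le show ?thesis by (simp add: s(1) lookup_add)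
    qed
  qed
  show "disjoint_family_on (\<lambda>r. (+) r ` exponents (Z r)) R"
    unfolding disjoint_family_on_def
  proof (intro ballI impI)
    fix r s assume rs: "r \<in> R" "s \<in> R" "r \<noteq> s"
    show "(+) r ` exponents (Z r) \<inter> (+) s ` exponents (Z s) = {}"
    proof (rule ccontr)
      assume "(+) r ` exponents (Z r) \<inter> (+) s ` exponents (Z s) \<noteq> {}"
      then obtain t where "t \<in> (+) r ` exponents (Z r)" "t \<in> (+) s ` exponents (Z s)"
        by blast
      with rs truncation have "r = s"
        by (intro R_eqI) simp_all
      with rs(3) show False by contradiction
    qed
  qed
  show "(\<Union>r\<in>R. (+) r ` exponents (Z r)) = E"
  proof
    show "(\<Union>r\<in>R. (+) r ` exponents (Z r)) \<subseteq> E"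
    proof clarify
      fix r s assume "r \<in> R" "s \<in> exponents (Z r)"
      moreover from this have "s \<in> exponents {1..n}"
        by (auto simp: exponents_def Z_def)
      moreover have "r \<in> E"
        using calculation by (auto simp: R_def)
      ultimately show "r + s \<in> E"
        using E by (intro up_closed[OF _ divs_add] exponents_add) auto
    qed
    show "E \<subseteq> (\<Union>r\<in>R. (+) r ` exponents (Z r))"
    proof
      fix t assume t: "t \<in> E"
      \<comment> \<open>Coordinate 1 is left as in \<open>t\<close>. The vector stays in
        \<open>E\<close> because a minimal element below \<open>t\<close> has all exponents bounded
        by \<open>b\<close> and hence also divides \<open>u\<close>.\<close>
      define u where "u = Poly_Mapping.mapp (\<lambda>k c. if k \<in> {2..n} then min c (b k) else c) t"
      have lookup_u: "lookup u k = (if k \<in> {2..n} then min (lookup t k) (b k) else lookup t k)" for k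
        by (auto simp: u_def lookup_mapp when_def in_keys_iff)
      obtain g where g: "g \<in> minimal_elements E" "g \<preceq> t"
        using minimal_element_below[OF E t] .
      have "g \<preceq> u"
        using g bound[OF g(1)] by (auto simp: divs_def lookup_u)
      moreover have "u \<in> exponents {1..n}"
        using t E by (force simp: exponents_iff lookup_u)
      ultimately have "u \<in> E"
        using up_closed g(1) by (auto simp: minimal_elements_def)
      let ?P = "\<lambda>s. s \<in> E \<and> (\<forall>k\<in>{2..n}. lookup s k = lookup u k)"
      \<comment> \<open>Since \<open>u\<close> competes in this minimization and has the same first
        coordinate as \<open>t\<close>, the chosen \<open>r\<close> divides
        \<open>t\<close>.\<close>
      obtain r where r: "?P r" and least: "\<And>s. ?P s \<Longrightarrow> lookup r 1 \<le> lookup s 1"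
        using ex_has_least_nat[of ?P u "\<lambda>s. lookup s 1"] \<open>u \<in> E\<close> by auto
      have "r \<in> R"
        using r least by (auto simp: R_def lookup_u)
      moreover have "r \<preceq> t"
        unfolding divs_def
      proof
        fix k
        consider "k \<in> {2..n}" | "k = 1" | "k \<notin> {1..n}"
          by force
        then show "lookup r k \<le> lookup t k"
        proof cases
          case 1
          with r show ?thesis by (simp add: lookup_u)
        next
          case 2
          with least[of u] \<open>u \<in> E\<close> show ?thesis by (simp add: lookup_u)
        next
          case 3
          moreover have "r \<in> exponents {1..n}"
            using r E by auto
          ultimately have "lookup r k = 0"
            by (metis exponents_iff)
          then show ?thesis by simp
        qed
      qed
      moreover have "t - r \<in> exponents (Z r)"
        unfolding exponents_iff
      proof (intro allI impI)
        fix k assume k: "k \<notin> Z r"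
        have "lookup t k = 0" if "k \<notin> {1..n}"
          using that t E by (auto simp: exponents_iff)
        moreover have "lookup r k = lookup t k" if "k \<in> {1..n}"
        proof -
          \<comment> \<open>Index 1 is excluded because it would lie in \<open>Z r\<close>. A
            minimum strictly below \<open>b k\<close> must be the exponent of
            \<open>t\<close>.\<close>
          have "k \<in> {2..n}" "lookup r k < b k"
            using k that by (auto simp: Z_def)
          moreover have "lookup r k = min (lookup t k) (b k)"
            using r calculation(1) by (simp add: lookup_u)
          ultimately show ?thesis by linarith
        qed
        ultimately show "lookup (t - r) k = 0"
          by (cases "k \<in> {1..n}") (auto simp: lookup_minus)
      qed
      ultimately show "t \<in> (\<Union>r\<in>R. (+) r ` exponents (Z r))"
        using divs_add_diff[of r t] by (metis UN_I image_eqI)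
    qed
  qed
qed

section \<open>Counting the truncations\<close>

theorem theorem2p17:
  fixes n :: nat and I :: "'k::field mpoly set"
  assumes "monomial_ideal n I" and "I \<noteq> {0}"
  shows "int (slength n I) \<le> (\<Prod>k=2..n. int (beta n I k) - int (alpha n I k) + 1)"
proof -
  obtain A where A: "A \<subseteq> exponents {1..n}" "I = Idl\<^bsub>poly_ring n\<^esub> (xpow ` A)"
    using assms(1) by (auto simp: monomial_ideal_def monomials_eq_image subset_image_iff)
  define E where "E = up_set n A"
  have I: "I = supported E"
    using genideal_monomials[OF A(1)] A(2) by (simp add: E_def)
  have up: "up_set n E = E"
    by (simp add: E_def up_set_absorb)
  have E: "E \<subseteq> exponents {1..n}"
    by (auto simp: E_def up_set_def)
  have "E \<noteq> {}"
    using assms(2) by (auto simp: I supported_def)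
  then obtain g where g: "g \<in> minimal_elements E"
    using minimal_element_below[OF E] by blast
  have alpha: "alpha n I k \<le> lookup t k" if "t \<in> E" for t k
    unfolding I using alpha_le_lookup[OF up that] .
  have beta: "lookup h k \<le> beta n I k" if "h \<in> minimal_elements E" for h k
    unfolding I using lookup_le_beta[OF up that] .
  define R where "R = {r \<in> E. (\<forall>k\<in>{2..n}. lookup r k \<le> beta n I k) \<and>
      (\<forall>s\<in>E. (\<forall>k\<in>{2..n}. lookup s k = lookup r k) \<longrightarrow> lookup r 1 \<le> lookup s 1)}"
  \<comment> \<open>For \<open>n = 0\<close> the index 1 is not a variable; the condition
    \<open>k \<in> {1..n}\<close> then leaves \<open>Z r\<close> empty.\<close>
  define Z where "Z = (\<lambda>r. {k \<in> {1..n}. k = 1 \<or> beta n I k \<le> lookup r k})"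
  note dec = truncation_decomposition[OF up beta, folded R_def Z_def]
  \<comment> \<open>Truncations are recorded as extensional functions on \<open>{2..n}\<close>,
    which places them in a finite product of intervals whose cardinality is the desired
    bound.\<close>
  let ?box = "\<Pi>\<^sub>E k\<in>{2..n}. {alpha n I k..beta n I k}"
  have box: "(\<lambda>r. restrict (lookup r) {2..n}) ` R \<subseteq> ?box" "finite ?box"
    using alpha by (auto simp: R_def intro: finite_PiE)
  then have "finite R"
    using finite_imageD[OF finite_subset[OF box] dec(3)] by simp
  then have "slength n I \<le> card R"
    unfolding I using E dec by (intro slength_supported_le[where Z = Z]) (auto simp: Z_def)
  also have "\<dots> \<le> card ?box"
    using card_inj_on_le[OF dec(3) box] .
  also have "\<dots> = (\<Prod>k=2..n. beta n I k + 1 - alpha n I k)"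
    by (simp add: card_PiE)
  finally have "int (slength n I) \<le> int (\<Prod>k=2..n. beta n I k + 1 - alpha n I k)"
    by (simp only: of_nat_le_iff)
  also have "\<dots> = (\<Prod>k=2..n. int (beta n I k) - int (alpha n I k) + 1)"
    unfolding of_nat_prod
  proof (rule prod.cong)
    fix k
    \<comment> \<open>Subtraction of naturals cuts off at 0, so this is what makes the passage to
      integers exact. The witness \<open>g\<close> exists because \<open>I\<close> is
      nonzero.\<close>
    have "alpha n I k \<le> beta n I k"
      using alpha[of g] beta[OF g] g by (auto simp: minimal_elements_def intro: order_trans)
    then show "int (beta n I k + 1 - alpha n I k) = int (beta n I k) - int (alpha n I k) + 1"
      by simp
  qed simp
  finally show ?thesis .
qed

end
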